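(* For every odd integer $n\ge 5$, the graph $AUQI(n,2)$ is a core of $QI(n,2)$.
   Context: For $n\ge 4$, $QI(n,2)$ is the graph whose vertices are all partitions $\{A_1,A_2\}$ of $\{1,\dots,n\}$ into two classes, each of size at least $2$; two vertices $\{A_1,A_2\}$, $\{B_1,B_2\}$ are adjacent if and only if $A_i\cap B_j\ne\emptyset$ for all $i,j\in\{1,2\}$. For $n$ odd, $AUQI(n,2)$ is the subgraph of $QI(n,2)$ induced by the almost-uniform partitions, i.e. those whose two classes have sizes $\frac{n-1}{2}$ and $\frac{n+1}{2}$. A graph is a core if every endomorphism of it (homomorphism to itself) is an automorphism. A core of a graph $G$ is a subgraph $G^\bullet$ of $G$ such that $G^\bullet$ is a core and there is a graph homomorphism $G\to G^\bullet$. *)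

theory Defs
  imports "Graph_Theory.Graph_Theory" "HOL-Library.Disjoint_Sets"
begin

text \<open>
  Graphs are the loop-free finite symmetric digraphs of the locale \<^locale>\<open>graph\<close>, so that
  \<open>u \<rightarrow>\<^bsub>G\<^esub> v\<close> is adjacency. Homomorphisms are maps on vertices; their values outside
  the vertex set are irrelevant.
\<close>

definition graph_hom :: "('a, 'b) pre_digraph \<Rightarrow> ('c, 'd) pre_digraph \<Rightarrow> ('a \<Rightarrow> 'c) \<Rightarrow> bool" where
  "graph_hom G H f \<longleftrightarrow>
     f ` verts G \<subseteq> verts H \<and> (\<forall>u v. u \<rightarrow>\<^bsub>G\<^esub> v \<longrightarrow> f u \<rightarrow>\<^bsub>H\<^esub> f v)"

definition graph_automorphism :: "('a, 'b) pre_digraph \<Rightarrow> ('a \<Rightarrow> 'a) \<Rightarrow> bool" where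
  "graph_automorphism G f \<longleftrightarrow>
     bij_betw f (verts G) (verts G) \<and>
     (\<forall>u \<in> verts G. \<forall>v \<in> verts G. u \<rightarrow>\<^bsub>G\<^esub> v \<longleftrightarrow> f u \<rightarrow>\<^bsub>G\<^esub> f v)"

definition is_core :: "('a, 'b) pre_digraph \<Rightarrow> bool" where
  "is_core G \<longleftrightarrow> (\<forall>f. graph_hom G G f \<longrightarrow> graph_automorphism G f)"

text \<open>
  \<^const>\<open>subgraph\<close> only requires its arguments to be digraphs, hence the explicit
  symmetry requirement contained in \<^term>\<open>graph H\<close>.
\<close>

definition core_of :: "('a, 'b) pre_digraph \<Rightarrow> ('a, 'b) pre_digraph \<Rightarrow> bool" where
  "core_of H G \<longleftrightarrow> graph H \<and> subgraph H G \<and> is_core H \<and> (\<exists>f. graph_hom G H f)"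

definition QI_verts :: "nat \<Rightarrow> nat set set set" where
  "QI_verts n = {P. partition_on {1..n} P \<and> card P = 2 \<and> (\<forall>A \<in> P. card A \<ge> 2)}"

definition QI :: "nat \<Rightarrow> (nat set set, nat set set \<times> nat set set) pre_digraph" where
  "QI n = with_proj
     \<lparr> pverts = QI_verts n,
       parcs = {(P, Q). P \<in> QI_verts n \<and> Q \<in> QI_verts n \<and> (\<forall>A \<in> P. \<forall>B \<in> Q. A \<inter> B \<noteq> {})} \<rparr>"

text \<open>Only meaningful for odd \<open>n\<close>, when both divisions are exact.\<close>

definition AUQI :: "nat \<Rightarrow> (nat set set, nat set set \<times> nat set set) pre_digraph" where
  "AUQI n = QI n \<restriction> {P \<in> verts (QI n). card ` P = {(n - 1) div 2, (n + 1) div 2}}"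

lemma (in nomulti_digraph) graph_automorphism_iff_digraph_isomorphism:
  "graph_automorphism G f \<longleftrightarrow>
     (\<exists>h. digraph_isomorphism h \<and> app_iso h G = G \<and> iso_verts h = f)"
proof
  assume f: "graph_automorphism G f"
  then have inj: "inj_on f (verts G)" and im: "f ` verts G = verts G"
    by (auto simp: graph_automorphism_def bij_betw_def)
  define k where "k e = (THE e'. e' \<in> arcs G \<and> tail G e' = f (tail G e) \<and> head G e' = f (head G e))" for e
  have ex1: "\<exists>!e'. e' \<in> arcs G \<and> tail G e' = f (tail G e) \<and> head G e' = f (head G e)"
    if e: "e \<in> arcs G" for e
  proof -
    have "tail G e \<rightarrow>\<^bsub>G\<^esub> head G e"
      using e by (auto simp: arcs_ends_conv)
    then have "f (tail G e) \<rightarrow>\<^bsub>G\<^esub> f (head G e)"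
      using f e by (auto simp: graph_automorphism_def)
    then show ?thesis
      by (elim reachableE, intro ex1I) (auto intro: no_multi_arcs simp: arc_to_ends_def)
  qed
  have k: "k e \<in> arcs G \<and> tail G (k e) = f (tail G e) \<and> head G (k e) = f (head G e)"
    if "e \<in> arcs G" for e
    unfolding k_def by (rule theI'[OF ex1[OF that]])
  have injk: "inj_on k (arcs G)"
  proof (rule inj_onI)
    fix a b assume ab: "a \<in> arcs G" "b \<in> arcs G" "k a = k b"
    then have "f (tail G a) = f (tail G b)" "f (head G a) = f (head G b)"
      using k by metis+
    then show "a = b"
      using ab inj by (intro no_multi_arcs) (auto simp: arc_to_ends_def dest: inj_onD)
  qed
  have imk: "k ` arcs G = arcs G"
  proof (intro subset_antisym subsetI)
    fix e assume "e \<in> k ` arcs G" then show "e \<in> arcs G" using k by auto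
  next
    fix e assume e: "e \<in> arcs G"
    then have "tail G e \<in> f ` verts G" "head G e \<in> f ` verts G"
      by (simp_all add: im)
    then obtain u v where uv: "u \<in> verts G" "v \<in> verts G" "tail G e = f u" "head G e = f v"
      by blast
    have "f u \<rightarrow>\<^bsub>G\<^esub> f v"
      using e uv by (force simp: arcs_ends_conv)
    then have "u \<rightarrow>\<^bsub>G\<^esub> v"
      using f uv by (auto simp: graph_automorphism_def)
    then obtain a where a: "a \<in> arcs G" "tail G a = u" "head G a = v" by blast
    then have "k a = e"
      using k[of a] e uv by (intro no_multi_arcs) (auto simp: arc_to_ends_def)
    then show "e \<in> k ` arcs G" using a by blast
  qed
  let ?h = "\<lparr> iso_verts = f, iso_arcs = k, iso_head = head G, iso_tail = tail G \<rparr>"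
  have "digraph_isomorphism ?h"
    using inj injk k wf_digraph by (auto simp: digraph_isomorphism_def)
  moreover have "app_iso ?h G = G"
    by (intro pre_digraph.equality) (auto simp: im imk)
  ultimately show "\<exists>h. digraph_isomorphism h \<and> app_iso h G = G \<and> iso_verts h = f"
    by force
next
  assume "\<exists>h. digraph_isomorphism h \<and> app_iso h G = G \<and> iso_verts h = f"
  then obtain h where h: "digraph_isomorphism h" "app_iso h G = G" "iso_verts h = f" by blast
  have im: "f ` verts G = verts G" and imk: "iso_arcs h ` arcs G = arcs G"
    and th: "iso_tail h = tail G" "iso_head h = head G"
    using h by (metis app_iso_simps)+
  have inj: "inj_on f (verts G)"
    using h by (auto simp: digraph_isomorphism_def)
  have ends: "tail G (iso_arcs h e) = f (tail G e) \<and> head G (iso_arcs h e) = f (head G e)"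
    if "e \<in> arcs G" for e
    using h that th by (auto simp: digraph_isomorphism_def)
  have "u \<rightarrow>\<^bsub>G\<^esub> v \<longleftrightarrow> f u \<rightarrow>\<^bsub>G\<^esub> f v" if uv: "u \<in> verts G" "v \<in> verts G" for u v
  proof
    assume "u \<rightarrow>\<^bsub>G\<^esub> v"
    then obtain e where e: "e \<in> arcs G" "tail G e = u" "head G e = v" by blast
    then have "iso_arcs h e \<in> arcs G" using imk by blast
    then show "f u \<rightarrow>\<^bsub>G\<^esub> f v"
      using ends[of e] e by (force simp: arcs_ends_conv)
  next
    assume "f u \<rightarrow>\<^bsub>G\<^esub> f v"
    then obtain e where e: "e \<in> arcs G" "tail G e = f u" "head G e = f v" by blast
    then obtain a where a: "a \<in> arcs G" "e = iso_arcs h a" using imk by blast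
    then have "tail G a = u" "head G a = v"
      using ends[of a] e uv inj by (auto dest: inj_onD)
    then show "u \<rightarrow>\<^bsub>G\<^esub> v"
      using a by (force simp: arcs_ends_conv)
  qed
  then show "graph_automorphism G f"
    using inj im by (auto simp: graph_automorphism_def bij_betw_def)
qed

lemma graph_QI: "graph (QI n)"
proof -
  let ?V = "QI_verts n"
  let ?E = "{(P, Q). P \<in> ?V \<and> Q \<in> ?V \<and> (\<forall>A \<in> P. \<forall>B \<in> Q. A \<inter> B \<noteq> {})}"
  have "?V \<subseteq> Pow (Pow {1..n})"
    by (auto simp: QI_verts_def partition_on_def)
  then have fin: "finite ?V"
    by (rule finite_subset) simp
  have "?E \<subseteq> ?V \<times> ?V" by blast
  then have finE: "finite ?E"
    by (rule finite_subset) (simp add: fin)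
  have loop: "P \<noteq> Q" if "(P, Q) \<in> ?E" for P Q
  proof
    assume "P = Q"
    from that have "card P = 2" "disjoint P"
      by (simp_all add: QI_verts_def partition_on_def)
    then obtain A B where "A \<in> P" "B \<in> P" "A \<inter> B = {}"
      by (metis card_2_iff insertCI disjointD)
    with that \<open>P = Q\<close> show False by blast
  qed
  have sym: "sym ?E" by (rule symI) fast
  have "pair_graph \<lparr> pverts = ?V, parcs = ?E \<rparr>"
  proof
    show "finite (pverts \<lparr> pverts = ?V, parcs = ?E \<rparr>)" using fin by simp
    show "finite (parcs \<lparr> pverts = ?V, parcs = ?E \<rparr>)" using finE by simp
    show "symmetric (with_proj \<lparr> pverts = ?V, parcs = ?E \<rparr>)"
      using sym by (simp only: symmetric_def with_proj_simps pair_pre_digraph.simps)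
    fix e assume e: "e \<in> parcs \<lparr> pverts = ?V, parcs = ?E \<rparr>"
    then have e': "(fst e, snd e) \<in> ?E" by (simp only: pair_pre_digraph.simps prod.collapse)
    then show "fst e \<noteq> snd e" by (rule loop)
    from e' show "fst e \<in> pverts \<lparr> pverts = ?V, parcs = ?E \<rparr>" by (auto split: prod.splits)
    from e' show "snd e \<in> pverts \<lparr> pverts = ?V, parcs = ?E \<rparr>" by (auto split: prod.splits)
  qed
  then show ?thesis
    unfolding QI_def by (rule pair_graph.pair_graphD_graph)
qed

lemma induced_subgraph_AUQI: "induced_subgraph (AUQI n) (QI n)"
proof -
  interpret graph "QI n" by (rule graph_QI)
  show ?thesis unfolding AUQI_def by (rule induced_induce) auto
qed

end

theory Submission
  imports Defs
begin

text \<open>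
  Let \<open>n = 2k + 1\<close>. A partition of \<open>{1..n}\<close> into two classes is determined by its smaller
  class \<open>A\<close>, of size at most \<open>k\<close>; two smaller classes \<open>A\<close> and \<open>B\<close> give adjacent vertices iff
  they meet and neither contains the other, since two sets of size at most \<open>k\<close> cannot cover
  \<open>{1..n}\<close>. The almost-uniform partitions correspond to the \<open>k\<close>-sets, and \<open>k\<close>-sets are
  adjacent iff they are distinct and meet: \<open>AUQI n\<close> is the complement of the odd graph, that is,
  of the Kneser graph of \<open>k\<close>-subsets of a \<open>(2k+1)\<close>-set.

  A homomorphism from \<open>QI n\<close> to \<open>AUQI n\<close>: enlarge every \<open>A\<close> to the \<open>k\<close>-set \<open>F A\<close> in its chain
  of a symmetric chain decomposition of the Boolean lattice (\<open>obtain_chain_completion\<close>). Sets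
  that meet have images that meet, and incomparable sets lie in different chains, hence have
  different images.

  The core property (\<open>kneser_compl_endo_inj\<close>): suppose that some endomorphism of \<open>AUQI n\<close> is not
  injective, and take an endomorphism \<open>g\<close> whose image \<open>W\<close> is as small as possible. It identifies
  two vertices \<open>A\<close> and \<open>B\<close>. Distinct vertices with the same value are not adjacent, so they are
  disjoint \<open>k\<close>-sets; as three pairwise disjoint \<open>k\<close>-sets do not fit into \<open>2k + 1\<close> points when
  \<open>k \<ge> 2\<close>, the fibre is exactly \<open>{A, B}\<close>. For a permutation \<open>p\<close> of the points,
  minimality forces \<open>g\<close> to map \<open>p(W)\<close> bijectively onto \<open>W\<close>, so \<open>p(W)\<close> contains exactly one of
  \<open>A\<close> and \<open>B\<close>. Any pair of disjoint \<open>k\<close>-sets is carried to \<open>(A, B)\<close> by some \<open>p\<close>; hence \<open>W\<close>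
  contains exactly one member of each such pair. In other words \<open>W\<close> is one side of a
  bipartition of the odd graph, which is impossible because that graph has an odd cycle. So every
  endomorphism is injective and, by finiteness, an automorphism.
\<close>

section \<open>Symmetric chains in the Boolean lattice\<close>

text \<open>
  The function \<open>c\<close> assigns to each subset the chain it belongs to. The second property says that a
  chain is saturated and symmetric about the middle level without mentioning its endpoints: with a
  set of size \<open>a\<close> it has a set of every size between \<open>a\<close> and \<open>card X - a\<close>.

  When a point \<open>x\<close> is added, a chain \<open>A\<^sub>0 \<subset> \<dots> \<subset> A\<^sub>m\<close> becomes two: the original chain extended by
  \<open>A\<^sub>m \<union> {x}\<close>, and the sets \<open>A\<^sub>i \<union> {x}\<close> with \<open>i < m\<close>. They get the labels \<open>2c\<close> and \<open>2c + 1\<close>.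
\<close>

lemma symmetric_chain_labelling:
  assumes "finite X"
  shows "\<exists>c :: 'a set \<Rightarrow> nat.
    (\<forall>A B. A \<subseteq> X \<longrightarrow> B \<subseteq> X \<longrightarrow> c A = c B \<longrightarrow> A \<subseteq> B \<or> B \<subseteq> A) \<and>
    (\<forall>A j. A \<subseteq> X \<longrightarrow> min (card A) (card X - card A) \<le> j \<longrightarrow> j \<le> max (card A) (card X - card A)
       \<longrightarrow> (\<exists>B \<subseteq> X. c B = c A \<and> card B = j))"
  using assms
proof (induction X)
  case empty
  show ?case by (rule exI[of _ "\<lambda>_. 0"]) auto
next
  case (insert x X)
  then obtain c :: "'a set \<Rightarrow> nat" where
    chain: "\<And>A B. A \<subseteq> X \<Longrightarrow> B \<subseteq> X \<Longrightarrow> c A = c B \<Longrightarrow> A \<subseteq> B \<or> B \<subseteq> A" and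
    sizes: "\<And>A j. A \<subseteq> X \<Longrightarrow> min (card A) (card X - card A) \<le> j \<Longrightarrow>
       j \<le> max (card A) (card X - card A) \<Longrightarrow> \<exists>B \<subseteq> X. c B = c A \<and> card B = j"
    by metis
  have fin: "finite A" if "A \<subseteq> X" for A using that insert.hyps finite_subset by blast
  have le: "card A \<le> card X" if "A \<subseteq> X" for A using that insert.hyps card_mono by blast
  have bigger: "A \<subset> B" if "A \<subseteq> X" "B \<subseteq> X" "c A = c B" "card A < card B" for A B
    using chain[OF that(1,2,3)] that(4) card_mono[OF fin[OF that(1)], of B] by auto
  define top where "top A \<longleftrightarrow> \<not> (\<exists>B \<subseteq> X. c B = c A \<and> A \<subset> B)" for A
  define d where "d A = (if x \<notin> A then 2 * c A
      else if top (A - {x}) then 2 * c (A - {x}) else 2 * c (A - {x}) + 1)" for A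
  have d0: "d A = 2 * c A" if "A \<subseteq> X" for A using that insert.hyps by (auto simp: d_def)
  have d1: "d (insert x A) = (if top A then 2 * c A else 2 * c A + 1)" if "A \<subseteq> X" for A
  proof -
    have "insert x A - {x} = A" using that insert.hyps by auto
    then show ?thesis by (simp add: d_def)
  qed
  have below_top: "A \<subseteq> B" if "A \<subseteq> X" "B \<subseteq> X" "c A = c B" "top B" for A B
    using chain[OF that(1-3)] that unfolding top_def by blast
  have split: "A \<subseteq> X \<or> (\<exists>A' \<subseteq> X. A = insert x A')" if "A \<subseteq> insert x X" for A
  proof (cases "x \<in> A")
    case True
    then have "A = insert x (A - {x})" "A - {x} \<subseteq> X" using that by auto
    then show ?thesis by blast
  qed (use that in auto)
  have card1: "card (insert x A) = Suc (card A)" if "A \<subseteq> X" for A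
    using that insert.hyps fin[OF that] by (metis card_insert_disjoint in_mono)
  have "A \<subseteq> B \<or> B \<subseteq> A" if AB: "A \<subseteq> insert x X" "B \<subseteq> insert x X" and eq: "d A = d B" for A B
  proof -
    consider "A \<subseteq> X" "B \<subseteq> X" | A' where "A' \<subseteq> X" "A = insert x A'" "B \<subseteq> X"
      | B' where "B' \<subseteq> X" "B = insert x B'" "A \<subseteq> X"
      | A' B' where "A' \<subseteq> X" "A = insert x A'" "B' \<subseteq> X" "B = insert x B'"
      using split[OF AB(1)] split[OF AB(2)] by blast
    moreover have odd_even: "2 * i + 1 \<noteq> 2 * j" "2 * j \<noteq> 2 * i + 1" for i j :: nat by presburger+
    ultimately show ?thesis
    proof cases
      case 1
      then show ?thesis using eq chain by (simp add: d0)
    next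
      case 2
      then have "top A'" "c A' = c B"
        using eq odd_even by (metis d0 d1 mult_cancel1 zero_neq_numeral)+
      then show ?thesis using below_top[of B A'] 2 by auto
    next
      case 3
      then have "top B'" "c B' = c A"
        using eq odd_even by (metis d0 d1 mult_cancel1 zero_neq_numeral)+
      then show ?thesis using below_top[of A B'] 3 by auto
    next
      case 4
      then have "c A' = c B'"
        using eq odd_even by (metis d1 mult_cancel1 zero_neq_numeral add_right_cancel)
      then show ?thesis using chain[of A' B'] 4 by auto
    qed
  qed
  moreover have "\<exists>B \<subseteq> insert x X. d B = d A \<and> card B = j"
    if A: "A \<subseteq> insert x X" and j: "min (card A) (card (insert x X) - card A) \<le> j"
      "j \<le> max (card A) (card (insert x X) - card A)" for A j
  proof -
    have X1: "card (insert x X) = Suc (card X)" using insert.hyps by simp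
    consider (out) "A \<subseteq> X" | (in_top) A' where "A' \<subseteq> X" "A = insert x A'" "top A'"
      | (in_low) A' where "A' \<subseteq> X" "A = insert x A'" "\<not> top A'"
      using split[OF A] by blast
    then show ?thesis
    proof cases
      case out
      show ?thesis
      proof (cases "min (card A) (card X - card A) \<le> j \<and> j \<le> max (card A) (card X - card A)")
        case True
        then obtain B where "B \<subseteq> X" "c B = c A" "card B = j" using sizes out by blast
        then show ?thesis using out by (intro exI[of _ B]) (auto simp: d0)
      next
        case False
        \<comment> \<open>The only size that the old chain need not provide is the new upper end.\<close>
        then have ja: "j = Suc (card X) - card A" "card A \<le> card X - card A"
          using j X1 le[OF out] by auto
        obtain D where D: "D \<subseteq> X" "c D = c A" "card D = card X - card A"
          using sizes[OF out, of "card X - card A"] by auto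
        show ?thesis
        proof (cases "top D")
          case True
          then show ?thesis using D ja out le[OF out]
            by (intro exI[of _ "insert x D"]) (auto simp: d0 d1 card1)
        next
          case False
          then obtain E where E: "E \<subseteq> X" "c E = c D" "D \<subset> E" unfolding top_def by blast
          then have "card D < card E" using fin psubset_card_mono by blast
          then have "\<exists>B \<subseteq> X. c B = c E \<and> card B = j"
            using ja D(3) le[OF out] le[OF E(1)] by (intro sizes E) auto
          then obtain B where "B \<subseteq> X" "c B = c E" "card B = j" by blast
          then show ?thesis using out D E by (intro exI[of _ B]) (auto simp: d0)
        qed
      qed
    next
      case in_top
      \<comment> \<open>Otherwise the chain would have a set of the larger size \<open>card X - card A'\<close>.\<close>
      have big: "card X - card A' \<le> card A'"
      proof (rule ccontr)
        assume less: "\<not> ?thesis"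
        obtain D where D: "D \<subseteq> X" "c D = c A'" "card D = card X - card A'"
          using sizes[OF in_top(1), of "card X - card A'"] by auto
        then have "A' \<subset> D" using bigger[of A' D] in_top less by simp
        then show False using in_top(3) D unfolding top_def by blast
      qed
      show ?thesis
      proof (cases "j = Suc (card A')")
        case True
        then show ?thesis using in_top A by (intro exI[of _ A]) (auto simp: card1)
      next
        case False
        then have "\<exists>B \<subseteq> X. c B = c A' \<and> card B = j"
          using j X1 big le[OF in_top(1)] in_top by (intro sizes) (auto simp: card1)
        then obtain B where "B \<subseteq> X" "c B = c A'" "card B = j" by blast
        then show ?thesis using in_top by (intro exI[of _ B]) (auto simp: d0 d1)
      qed
    next
      case in_low
      obtain E where E: "E \<subseteq> X" "c E = c A'" "A' \<subset> E" using in_low(3) unfolding top_def by blast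
      then have AE: "card A' < card E" using fin psubset_card_mono by blast
      have j': "j > 0" "min (card A') (card X - Suc (card A')) \<le> j - 1"
          "j - 1 \<le> max (card A') (card X - Suc (card A'))"
        using j X1 in_low le[OF E(1)] AE by (auto simp: card1)
      \<comment> \<open>The set to be found is \<open>insert x B\<close> with \<open>B\<close> not the top of its chain. A member \<open>D\<close> of
        the chain of size \<open>H > j - 1\<close> is the witness for this.\<close>
      define H where "H = (if card A' < card X - card A' then card X - card A' else card E)"
      have "\<exists>D \<subseteq> X. c D = c A' \<and> card D = H"
        using sizes[OF in_low(1), of "card X - card A'"] E by (auto simp: H_def)
      then obtain D where D: "D \<subseteq> X" "c D = c A'" "card D = H" by blast
      have "min (card D) (card X - card D) \<le> j - 1" "j - 1 < card D"
        using j' D(3) AE le[OF E(1)] by (auto simp: H_def split: if_splits)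
      then obtain B where B: "B \<subseteq> X" "c B = c D" "card B = j - 1"
        using sizes[OF D(1), of "j - 1"] by (metis less_imp_le max.coboundedI1)
      then have "B \<subset> D" using bigger[of B D] \<open>j - 1 < card D\<close> D by simp
      then have "\<not> top B" using B D unfolding top_def by metis
      then show ?thesis using B D in_low j'(1)
        by (intro exI[of _ "insert x B"]) (auto simp: d1 card1)
    qed
  qed
  ultimately show ?case by blast
qed

text \<open>
  A symmetric chain with a set of size at most \<open>k\<close> also has a set of size exactly \<open>k\<close>; \<open>F\<close> picks
  it, so two sets with the same image lie in one chain.
\<close>

lemma obtain_chain_completion:
  assumes X: "finite X" and k: "2 * k \<le> card X"
  obtains F :: "'a set \<Rightarrow> 'a set" where
    "\<And>A. A \<subseteq> X \<Longrightarrow> card A \<le> k \<Longrightarrow> A \<subseteq> F A \<and> F A \<subseteq> X \<and> card (F A) = k" and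
    "\<And>A B. A \<subseteq> X \<Longrightarrow> card A \<le> k \<Longrightarrow> B \<subseteq> X \<Longrightarrow> card B \<le> k \<Longrightarrow> F A = F B \<Longrightarrow> A \<subseteq> B \<or> B \<subseteq> A"
proof -
  from symmetric_chain_labelling[OF X] obtain c :: "'a set \<Rightarrow> nat" where
    chain: "\<forall>A B. A \<subseteq> X \<longrightarrow> B \<subseteq> X \<longrightarrow> c A = c B \<longrightarrow> A \<subseteq> B \<or> B \<subseteq> A" and
    sizes: "\<forall>A j. A \<subseteq> X \<longrightarrow> min (card A) (card X - card A) \<le> j \<longrightarrow>
       j \<le> max (card A) (card X - card A) \<longrightarrow> (\<exists>B \<subseteq> X. c B = c A \<and> card B = j)"
    by (elim exE conjE) (rule that)
  define F where "F A = (SOME B. B \<subseteq> X \<and> c B = c A \<and> card B = k)" for A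
  have F: "F A \<subseteq> X \<and> c (F A) = c A \<and> card (F A) = k" if A: "A \<subseteq> X" "card A \<le> k" for A
  proof -
    have "min (card A) (card X - card A) \<le> k" "k \<le> max (card A) (card X - card A)"
      using A k by auto
    then have "\<exists>B. B \<subseteq> X \<and> c B = c A \<and> card B = k" using sizes A(1) by blast
    then show ?thesis unfolding F_def by (rule someI_ex)
  qed
  show thesis
  proof (rule that[of F])
    fix A assume A: "A \<subseteq> X" "card A \<le> k"
    then have "A \<subseteq> F A \<or> F A \<subseteq> A" using F[OF A] chain by simp
    then have "A \<subseteq> F A"
      using card_seteq[of A "F A"] F[OF A] A finite_subset[OF A(1) X] by auto
    then show "A \<subseteq> F A \<and> F A \<subseteq> X \<and> card (F A) = k" using F[OF A] by simp
    fix B assume B: "B \<subseteq> X" "card B \<le> k" and "F A = F B"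
    then have "c A = c B" using F[OF A] F[OF B] by simp
    then show "A \<subseteq> B \<or> B \<subseteq> A" using chain A B by simp
  qed
qed

section \<open>Endomorphisms of the complement of the odd graph\<close>

text \<open>
  Automorphisms induced by permutations act transitively on ordered pairs of disjoint \<open>k\<close>-sets.
\<close>

lemma exists_bij_mapping_disjoint_pair:
  assumes N: "finite N" and A: "A \<subseteq> N" "B \<subseteq> N" "A \<inter> B = {}" and A': "A' \<subseteq> N" "B' \<subseteq> N" "A' \<inter> B' = {}"
    and c: "card A = card A'" "card B = card B'"
  shows "\<exists>p. bij_betw p N N \<and> p ` A = A' \<and> p ` B = B'"
proof -
  note fin = finite_subset[OF _ N]
  obtain f where f: "bij_betw f A A'"
    using finite_same_card_bij[OF fin[OF A(1)] fin[OF A'(1)] c(1)] by blast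
  obtain g where g: "bij_betw g B B'"
    using finite_same_card_bij[OF fin[OF A(2)] fin[OF A'(2)] c(2)] by blast
  have "card (N - (A \<union> B)) = card (N - (A' \<union> B'))"
    using A A' c fin by (simp add: card_Diff_subset card_Un_disjoint)
  then obtain h where h: "bij_betw h (N - (A \<union> B)) (N - (A' \<union> B'))"
    using N by (meson finite_Diff finite_same_card_bij)
  define p where "p x = (if x \<in> A then f x else if x \<in> B then g x else h x)" for x
  have pA: "bij_betw p A A'"
    using f by (rule bij_betw_cong[THEN iffD1, rotated]) (simp add: p_def)
  have pB: "bij_betw p B B'"
    using g by (rule bij_betw_cong[THEN iffD1, rotated]) (use A in \<open>auto simp: p_def\<close>)
  have pC: "bij_betw p (N - (A \<union> B)) (N - (A' \<union> B'))"
    using h by (rule bij_betw_cong[THEN iffD1, rotated]) (auto simp: p_def)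
  have "bij_betw p (A \<union> B \<union> (N - (A \<union> B))) (A' \<union> B' \<union> (N - (A' \<union> B')))"
    using pA pB pC A' by (intro bij_betw_combine) auto
  moreover have "A \<union> B \<union> (N - (A \<union> B)) = N" "A' \<union> B' \<union> (N - (A' \<union> B')) = N"
    using A A' by auto
  ultimately show ?thesis using pA pB by (auto simp: bij_betw_def)
qed

text \<open>
  Endomorphisms of the complement of the Kneser graph of the \<open>k\<close>-subsets of \<open>N\<close>: there, adjacent
  means distinct and not disjoint.
\<close>

definition kneser_compl_endo :: "'a set \<Rightarrow> nat \<Rightarrow> ('a set \<Rightarrow> 'a set) \<Rightarrow> bool" where
  "kneser_compl_endo N k g \<longleftrightarrow>
     (\<forall>A. A \<subseteq> N \<and> card A = k \<longrightarrow> g A \<subseteq> N \<and> card (g A) = k) \<and>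
     (\<forall>A B. A \<subseteq> N \<and> card A = k \<and> B \<subseteq> N \<and> card B = k \<and> A \<noteq> B \<and> A \<inter> B \<noteq> {}
        \<longrightarrow> g A \<noteq> g B \<and> g A \<inter> g B \<noteq> {})"

lemma kneser_compl_endo_vertex:
  "kneser_compl_endo N k g \<Longrightarrow> A \<subseteq> N \<Longrightarrow> card A = k \<Longrightarrow> g A \<subseteq> N \<and> card (g A) = k"
  by (simp add: kneser_compl_endo_def)

lemma kneser_compl_endo_edge:
  "kneser_compl_endo N k g \<Longrightarrow> A \<subseteq> N \<Longrightarrow> card A = k \<Longrightarrow> B \<subseteq> N \<Longrightarrow> card B = k \<Longrightarrow>
    A \<noteq> B \<Longrightarrow> A \<inter> B \<noteq> {} \<Longrightarrow> g A \<noteq> g B \<and> g A \<inter> g B \<noteq> {}"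
  by (simp add: kneser_compl_endo_def)

lemma kneser_compl_endo_comp:
  assumes g: "kneser_compl_endo N k g" and h: "kneser_compl_endo N k h"
  shows "kneser_compl_endo N k (g \<circ> h)"
  unfolding kneser_compl_endo_def
proof (intro conjI allI impI; elim conjE)
  fix A assume A: "A \<subseteq> N" "card A = k"
  note hA = kneser_compl_endo_vertex[OF h A]
  then show "(g \<circ> h) A \<subseteq> N" "card ((g \<circ> h) A) = k"
    using kneser_compl_endo_vertex[OF g, of "h A"] by simp_all
  fix B assume B: "B \<subseteq> N" "card B = k" and AB: "A \<noteq> B" "A \<inter> B \<noteq> {}"
  show "(g \<circ> h) A \<noteq> (g \<circ> h) B" "(g \<circ> h) A \<inter> (g \<circ> h) B \<noteq> {}"
    using kneser_compl_endo_edge[OF g, of "h A" "h B"] hA kneser_compl_endo_vertex[OF h B]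
      kneser_compl_endo_edge[OF h A B AB] by simp_all
qed

lemma kneser_compl_endo_image:
  assumes "bij_betw p N N"
  shows "kneser_compl_endo N k ((`) p)"
  unfolding kneser_compl_endo_def
proof (intro conjI allI impI; elim conjE)
  have inj: "inj_on p N" and im: "p ` N = N" using assms by (auto simp: bij_betw_def)
  fix A assume A: "A \<subseteq> N" "card A = k"
  show "p ` A \<subseteq> N" using image_mono[OF A(1), of p] im by simp
  show "card (p ` A) = k" using card_image[OF inj_on_subset[OF inj A(1)]] A(2) by simp
  fix B assume B: "B \<subseteq> N" "card B = k" and AB: "A \<noteq> B" "A \<inter> B \<noteq> {}"
  show "p ` A \<noteq> p ` B" using inj_on_image_eq_iff[OF inj A(1) B(1)] AB(1) by simp
  show "p ` A \<inter> p ` B \<noteq> {}" using AB(2) by blast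
qed

text \<open>
  Two \<open>k\<close>-sets with a common disjoint \<open>k\<close>-set are both in \<open>W\<close> or both outside. The interval
  \<open>{i+1..i+k}\<close> and its shift by one have a union of \<open>k + 1\<close> points, so the remaining \<open>k\<close> points
  form such a common set. Shifting \<open>k\<close> times carries \<open>{1..k}\<close> to \<open>{k+1..2k}\<close>, which is disjoint
  from it. These sets trace an odd cycle of the odd graph.
\<close>

lemma no_transversal_of_disjoint_pairs:
  assumes k: "k \<ge> 1"
    and one: "\<And>A B. A \<subseteq> {1..2*k+1} \<Longrightarrow> card A = k \<Longrightarrow> B \<subseteq> {1..2*k+1} \<Longrightarrow> card B = k \<Longrightarrow>
      A \<inter> B = {} \<Longrightarrow> A \<in> W \<longleftrightarrow> B \<notin> W"
  shows False
proof -
  have "{i+1..i+k} \<in> W \<longleftrightarrow> {1..k} \<in> W" if "i \<le> k" for i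
    using that
  proof (induction i)
    case (Suc i)
    define C where "C = {1..2*k+1} - {i+1..i+k+1}"
    have C: "C \<subseteq> {1..2*k+1}" "card C = k"
      using Suc.prems by (auto simp: C_def card_Diff_subset)
    have "{i+1..i+k} \<in> W \<longleftrightarrow> C \<notin> W"
      using C Suc.prems by (intro one) (auto simp: C_def)
    moreover have "{Suc i+1..Suc i+k} \<in> W \<longleftrightarrow> C \<notin> W"
      using C Suc.prems by (intro one) (auto simp: C_def)
    ultimately show ?case using Suc by simp
  qed simp
  from this[of k] have "{k+1..k+k} \<in> W \<longleftrightarrow> {1..k} \<in> W" by simp
  moreover have "{1..k} \<in> W \<longleftrightarrow> {k+1..k+k} \<notin> W"
    using k by (intro one) auto
  ultimately show False by blast
qed

text \<open>
  An endomorphism with the smallest image, applied after any permutation of the points, is still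
  injective on that image; this turns one non-trivial fibre into a condition on all pairs of
  disjoint \<open>k\<close>-sets.
\<close>

lemma kneser_compl_endo_inj:
  assumes k: "k \<ge> 2" and g0: "kneser_compl_endo {1..2*k+1} k g0"
  shows "inj_on g0 {A. A \<subseteq> {1..2*k+1} \<and> card A = k}"
proof (rule ccontr)
  let ?N = "{1..2*k+1}"
  let ?endo = "kneser_compl_endo ?N k"
  define V where "V = {A. A \<subseteq> ?N \<and> card A = k}"
  have finV: "finite V" by (simp add: V_def)
  assume "\<not> inj_on g0 {A. A \<subseteq> ?N \<and> card A = k}"
  then have ninj0: "card (g0 ` V) < card V"
    using finV by (metis V_def card_image_le eq_card_imp_inj_on le_neq_implies_less)
  obtain g where g: "?endo g" and min: "\<And>h. ?endo h \<Longrightarrow> card (g ` V) \<le> card (h ` V)"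
    using ex_has_least_nat[of ?endo g0 "\<lambda>h. card (h ` V)"] g0 by blast
  have gV: "g ` V \<subseteq> V" using g by (auto simp: V_def kneser_compl_endo_def)
  have "\<not> inj_on g V" using ninj0 min[OF g0] by (auto dest: card_image)
  then obtain A B where AB: "A \<in> V" "B \<in> V" "A \<noteq> B" "g A = g B" by (auto simp: inj_on_def)
  have disj: "C \<inter> D = {}" if "C \<in> V" "D \<in> V" "C \<noteq> D" "g C = g D" for C D
    using g that unfolding kneser_compl_endo_def V_def by blast
  have finset: "finite C" if "C \<in> V" for C
    using that k by (auto simp: V_def intro: card_ge_0_finite)
  \<comment> \<open>Three pairwise disjoint \<open>k\<close>-sets would need \<open>3k > 2k + 1\<close> points.\<close>
  have fibre: "C = A \<or> C = B" if C: "C \<in> V" "g C = g A" for C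
  proof (rule ccontr)
    assume "\<not> ?thesis"
    then have "A \<inter> B = {}" "C \<inter> A = {}" "C \<inter> B = {}" using disj AB C by auto
    then have "card (A \<union> B) = card A + card B" "card (A \<union> B \<union> C) = card (A \<union> B) + card C"
      using AB C finset by (auto intro!: card_Un_disjoint)
    then have "card (A \<union> B \<union> C) = 3 * k" using AB C by (simp add: V_def)
    moreover have "card (A \<union> B \<union> C) \<le> card ?N" using AB C by (intro card_mono) (auto simp: V_def)
    ultimately show False using k by simp
  qed
  have "A' \<in> g ` V \<longleftrightarrow> B' \<notin> g ` V"
    if A'B': "A' \<subseteq> ?N" "card A' = k" "B' \<subseteq> ?N" "card B' = k" "A' \<inter> B' = {}" for A' B'
  proof -
    have "A \<subseteq> ?N" "B \<subseteq> ?N" "card A' = card A" "card B' = card B"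
      using AB(1,2) A'B' by (simp_all add: V_def)
    then obtain p where p: "bij_betw p ?N ?N" "p ` A' = A" "p ` B' = B"
      using exists_bij_mapping_disjoint_pair[OF _ A'B'(1,3,5) _ _ disj[OF AB]] by blast
    have pe: "?endo ((`) p)" using p kneser_compl_endo_image by blast
    have pV: "p ` C \<in> V" if "C \<in> V" for C using pe that by (auto simp: V_def kneser_compl_endo_def)
    let ?h = "g \<circ> (`) p"
    have h: "?endo ?h" by (intro kneser_compl_endo_comp g pe)
    have sub: "?h ` g ` V \<subseteq> g ` V" using gV pV by auto
    \<comment> \<open>The image of \<open>g \<circ> p \<circ> g\<close> lies in that of \<open>g\<close>, so by minimality the two coincide.\<close>
    have "card (g ` V) \<le> card (?h ` g ` V)"
      using min[OF kneser_compl_endo_comp[OF h g]] by (simp add: image_comp)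
    then have onto: "?h ` g ` V = g ` V" using sub finV by (simp add: card_seteq)
    then have inj: "inj_on ?h (g ` V)" using finV by (simp add: eq_card_imp_inj_on)
    have "\<not> (A' \<in> g ` V \<and> B' \<in> g ` V)"
    proof
      assume "A' \<in> g ` V \<and> B' \<in> g ` V"
      moreover have "?h A' = ?h B'" using p AB by simp
      ultimately have "A' = B'" using inj_onD[OF inj] by blast
      then show False using p AB by simp
    qed
    moreover have "A' \<in> g ` V \<or> B' \<in> g ` V"
    proof -
      have "g A \<in> ?h ` g ` V" using onto AB by auto
      then obtain C where C: "C \<in> g ` V" "g (p ` C) = g A" by auto
      have CN: "C \<subseteq> ?N" using C(1) gV by (auto simp: V_def)
      have "p ` C = p ` A' \<or> p ` C = p ` B'" using fibre[of "p ` C"] pV[of C] C gV p by blast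
      then have "C = A' \<or> C = B'"
        using inj_on_image_eq_iff[of p ?N C] bij_betw_imp_inj_on[OF p(1)] CN A'B'(1,3) by metis
      then show ?thesis using C by blast
    qed
    ultimately show ?thesis by blast
  qed
  then show False using no_transversal_of_disjoint_pairs[of k "g ` V"] k by simp
qed

text \<open>
  An injective endomorphism permutes the vertices and maps the finite set of adjacent pairs
  injectively into itself, hence onto itself; so it also reflects adjacency.
\<close>

lemma (in fin_digraph) inj_endomorphism_imp_automorphism:
  assumes f: "graph_hom G G f" and inj: "inj_on f (verts G)"
  shows "graph_automorphism G f"
proof -
  have im: "f ` verts G = verts G"
    using f inj by (simp add: graph_hom_def endo_inj_surj)
  let ?E = "arcs_ends G"
  have E: "u \<in> verts G \<and> v \<in> verts G" if "(u, v) \<in> ?E" for u v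
    using that by (auto simp: arcs_ends_conv)
  have finE: "finite ?E" by (simp add: arcs_ends_def)
  have sub: "map_prod f f ` ?E \<subseteq> ?E" using f by (auto simp: graph_hom_def)
  have "inj_on (map_prod f f) ?E"
    by (rule inj_on_subset[OF map_prod_inj_on[OF inj inj]]) (use E in auto)
  then have surj: "map_prod f f ` ?E = ?E" using finE sub by (simp add: endo_inj_surj)
  have "u \<rightarrow>\<^bsub>G\<^esub> v" if uv: "u \<in> verts G" "v \<in> verts G" "f u \<rightarrow>\<^bsub>G\<^esub> f v" for u v
  proof -
    have "(f u, f v) \<in> map_prod f f ` ?E" using uv surj by simp
    then obtain u' v' where "(u', v') \<in> ?E" "f u' = f u" "f v' = f v" by auto
    then show ?thesis using E uv inj by (metis inj_onD)
  qed
  then show ?thesis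
    using f inj im by (auto simp: graph_automorphism_def graph_hom_def bij_betw_def)
qed

section \<open>Vertices as subsets\<close>

definition bipart :: "nat \<Rightarrow> nat set \<Rightarrow> nat set set" where
  "bipart n A = {A, {1..n} - A}"

lemma bipart_compl: "A \<subseteq> {1..n} \<Longrightarrow> bipart n ({1..n} - A) = bipart n A"
  by (auto simp: bipart_def double_diff)

lemma bipart_in_QI_verts_iff:
  assumes A: "A \<subseteq> {1..n}"
  shows "bipart n A \<in> QI_verts n \<longleftrightarrow> 2 \<le> card A \<and> 2 \<le> n - card A"
proof -
  have c: "card ({1..n} - A) = n - card A" using A by (simp add: card_Diff_subset finite_subset)
  show ?thesis
  proof
    assume "bipart n A \<in> QI_verts n"
    then show "2 \<le> card A \<and> 2 \<le> n - card A" using c by (auto simp: QI_verts_def bipart_def)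
  next
    assume s: "2 \<le> card A \<and> 2 \<le> n - card A"
    then have "card A \<noteq> 0" "n - card A \<noteq> 0" by linarith+
    then have "card A \<noteq> 0" "card ({1..n} - A) \<noteq> 0" using c by argo+
    then have "A \<noteq> {}" "{1..n} - A \<noteq> {}" by (metis card.empty)+
    moreover from this have "A \<noteq> {1..n} - A" by blast
    ultimately show "bipart n A \<in> QI_verts n"
      using s c A by (auto simp: QI_verts_def bipart_def partition_on_def disjoint_def)
  qed
qed

lemma verts_QI: "verts (QI n) = QI_verts n"
  by (simp add: QI_def)

lemma adj_QI: "P \<rightarrow>\<^bsub>QI n\<^esub> Q \<longleftrightarrow>
    P \<in> QI_verts n \<and> Q \<in> QI_verts n \<and> (\<forall>A \<in> P. \<forall>B \<in> Q. A \<inter> B \<noteq> {})"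
  by (simp add: QI_def)

lemma adj_AUQI: "P \<rightarrow>\<^bsub>AUQI n\<^esub> Q \<longleftrightarrow>
    P \<in> verts (AUQI n) \<and> Q \<in> verts (AUQI n) \<and> P \<rightarrow>\<^bsub>QI n\<^esub> Q"
proof -
  interpret wf_digraph "QI n" using graph_QI graph.axioms
    by (meson digraph.axioms(1) fin_digraph.axioms(1))
  show ?thesis by (auto simp: AUQI_def arcs_ends_conv induce_subgraph_def)
qed

lemma graph_AUQI: "graph (AUQI n)"
proof -
  interpret graph "QI n" by (rule graph_QI)
  have "digraph (AUQI n)" using induced_subgraph_AUQI by (rule digraphI_induced)
  then show ?thesis
    using induced_graph_imp_graph[OF induced_subgraph_AUQI]
    by (simp add: graph_def pseudo_graph_def digraph_def)
qed

context
  fixes n k :: nat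
  assumes n: "n = 2 * k + 1"
begin

lemma bipart_inj:
  assumes "A \<subseteq> {1..n}" "card A \<le> k" "B \<subseteq> {1..n}" "card B \<le> k"
    and eq: "bipart n A = bipart n B"
  shows "A = B"
proof (rule ccontr)
  assume "A \<noteq> B"
  then have "A = {1..n} - B" using eq by (auto simp: bipart_def doubleton_eq_iff)
  then have "card A = n - card B"
    using assms(3) by (simp add: card_Diff_subset finite_subset)
  then show False using assms(2,4) n by simp
qed

lemma QI_verts_obtain:
  assumes P: "P \<in> QI_verts n"
  obtains A where "A \<subseteq> {1..n}" "2 \<le> card A" "card A \<le> k" "P = bipart n A"
proof -
  let ?N = "{1..n}"
  from P obtain A B where AB: "P = {A, B}" "A \<noteq> B" "partition_on ?N P"
    by (auto simp: QI_verts_def card_2_iff)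
  then have "A \<union> B = ?N" "A \<inter> B = {}"
    by (auto simp: partition_on_def disjoint_def)
  then have A: "A \<subseteq> ?N" and B: "B = ?N - A" by auto
  have c: "card B = n - card A" using A B by (simp add: card_Diff_subset finite_subset)
  have P_A: "P = bipart n A" using AB B by (simp add: bipart_def)
  have P_B: "P = bipart n B" using P_A B bipart_compl[OF A] by metis
  have 2: "2 \<le> card A" "2 \<le> card B" using P AB by (auto simp: QI_verts_def)
  show thesis
  proof (cases "card A \<le> k")
    case True
    then show thesis using that A 2 P_A by blast
  next
    case False
    then have "card B \<le> k" using c n by simp
    then show thesis using that[of B] B 2 P_B by blast
  qed
qed

text \<open>
  The two complements always meet, because \<open>A\<close> and \<open>B\<close> together have at most \<open>2k < n\<close> points. The
  two mixed conditions say that neither set contains the other.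
\<close>

lemma adj_QI_bipart:
  assumes A: "A \<subseteq> {1..n}" "2 \<le> card A" "card A \<le> k"
    and B: "B \<subseteq> {1..n}" "2 \<le> card B" "card B \<le> k"
  shows "bipart n A \<rightarrow>\<^bsub>QI n\<^esub> bipart n B \<longleftrightarrow>
    A \<inter> B \<noteq> {} \<and> \<not> A \<subseteq> B \<and> \<not> B \<subseteq> A"
proof -
  let ?N = "{1..n}"
  have "bipart n A \<in> QI_verts n" "bipart n B \<in> QI_verts n"
    using A B n by (simp_all add: bipart_in_QI_verts_iff)
  moreover have "(?N - A) \<inter> (?N - B) \<noteq> {}"
  proof
    assume "(?N - A) \<inter> (?N - B) = {}"
    then have "?N \<subseteq> A \<union> B" by blast
    then have "card ?N \<le> card (A \<union> B)"
      using A B by (intro card_mono) (auto intro: finite_subset)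
    then show False using card_Un_le[of A B] A B n by simp
  qed
  moreover have "A \<inter> (?N - B) \<noteq> {} \<longleftrightarrow> \<not> A \<subseteq> B" "(?N - A) \<inter> B \<noteq> {} \<longleftrightarrow> \<not> B \<subseteq> A"
    using A B by auto
  ultimately show ?thesis by (simp add: adj_QI bipart_def)
qed

lemma verts_AUQI:
  assumes k: "k \<ge> 2"
  shows "verts (AUQI n) = bipart n ` {A. A \<subseteq> {1..n} \<and> card A = k}"
proof (intro subset_antisym subsetI)
  have c: "card ({1..n} - A) = n - card A" if "A \<subseteq> {1..n}" for A
    using that by (simp add: card_Diff_subset finite_subset)
  {
    fix P assume "P \<in> verts (AUQI n)"
    then have P: "P \<in> QI_verts n" and cP: "card ` P = {k, k+1}"
      by (auto simp: AUQI_def verts_QI n)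
    then obtain A where A: "A \<subseteq> {1..n}" "card A \<le> k" "P = bipart n A"
      by (meson QI_verts_obtain)
    have "card A \<in> {k, k+1}" using A cP by (auto simp: bipart_def)
    then show "P \<in> bipart n ` {A. A \<subseteq> {1..n} \<and> card A = k}" using A by auto
  next
    fix P assume "P \<in> bipart n ` {A. A \<subseteq> {1..n} \<and> card A = k}"
    then obtain A where A: "A \<subseteq> {1..n}" "card A = k" "P = bipart n A" by blast
    then have "card ` P = {k, k+1}" using c[of A] n by (simp add: bipart_def)
    then show "P \<in> verts (AUQI n)"
      using A k n by (simp add: AUQI_def verts_QI bipart_in_QI_verts_iff)
  }
qed

lemma adj_AUQI_bipart:
  assumes k: "k \<ge> 2"
    and A: "A \<subseteq> {1..n}" "card A = k" and B: "B \<subseteq> {1..n}" "card B = k"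
  shows "bipart n A \<rightarrow>\<^bsub>AUQI n\<^esub> bipart n B \<longleftrightarrow> A \<noteq> B \<and> A \<inter> B \<noteq> {}"
proof -
  have "finite A" "finite B" using A B by (auto intro: finite_subset)
  then have "A \<subseteq> B \<longleftrightarrow> A = B" "B \<subseteq> A \<longleftrightarrow> A = B"
    using A B card_subset_eq[of B A] card_subset_eq[of A B] by auto
  moreover have "bipart n A \<in> verts (AUQI n)" "bipart n B \<in> verts (AUQI n)"
    using A B by (simp_all add: verts_AUQI[OF k])
  ultimately show ?thesis
    using adj_QI_bipart[of A B] A B k by (simp add: adj_AUQI conj_commute)
qed

section \<open>Almost-uniform partitions form a core\<close>

lemma exists_hom_QI_AUQI:
  assumes k: "k \<ge> 2"
  shows "\<exists>f. graph_hom (QI n) (AUQI n) f"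
proof -
  let ?N = "{1..n}"
  have "finite ?N" "2 * k \<le> card ?N" using n by simp_all
  then obtain F where F: "\<And>A. A \<subseteq> ?N \<Longrightarrow> card A \<le> k \<Longrightarrow> A \<subseteq> F A \<and> F A \<subseteq> ?N \<and> card (F A) = k"
    and chain: "\<And>A B. A \<subseteq> ?N \<Longrightarrow> card A \<le> k \<Longrightarrow> B \<subseteq> ?N \<Longrightarrow> card B \<le> k \<Longrightarrow> F A = F B \<Longrightarrow>
      A \<subseteq> B \<or> B \<subseteq> A"
    by (rule obtain_chain_completion) blast
  define S where "S P = (SOME A. A \<subseteq> ?N \<and> 2 \<le> card A \<and> card A \<le> k \<and> P = bipart n A)" for P
  have S: "S P \<subseteq> ?N \<and> 2 \<le> card (S P) \<and> card (S P) \<le> k \<and> P = bipart n (S P)"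
    if "P \<in> QI_verts n" for P
    unfolding S_def by (rule someI_ex) (rule QI_verts_obtain[OF that], blast)
  have "graph_hom (QI n) (AUQI n) (\<lambda>P. bipart n (F (S P)))"
    unfolding graph_hom_def
  proof (intro conjI allI impI)
    show "(\<lambda>P. bipart n (F (S P))) ` verts (QI n) \<subseteq> verts (AUQI n)"
      using S F k by (auto simp: verts_QI verts_AUQI)
    fix P Q assume PQ: "P \<rightarrow>\<^bsub>QI n\<^esub> Q"
    then have V: "P \<in> QI_verts n" "Q \<in> QI_verts n" by (simp_all add: adj_QI)
    note SP = S[OF V(1)] and SQ = S[OF V(2)]
    have adj: "S P \<inter> S Q \<noteq> {}" "\<not> S P \<subseteq> S Q" "\<not> S Q \<subseteq> S P"
      using PQ adj_QI_bipart[of "S P" "S Q"] SP SQ by auto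
    have "F (S P) \<noteq> F (S Q)" using adj chain[of "S P" "S Q"] SP SQ by blast
    moreover have "F (S P) \<inter> F (S Q) \<noteq> {}" using adj(1) F[of "S P"] F[of "S Q"] SP SQ by blast
    ultimately show "bipart n (F (S P)) \<rightarrow>\<^bsub>AUQI n\<^esub> bipart n (F (S Q))"
      using F SP SQ k by (simp add: adj_AUQI_bipart)
  qed
  then show ?thesis by blast
qed

lemma is_core_AUQI:
  assumes k: "k \<ge> 2"
  shows "is_core (AUQI n)"
  unfolding is_core_def
proof (intro allI impI)
  let ?N = "{1..n}"
  let ?V = "{A. A \<subseteq> ?N \<and> card A = k}"
  fix f assume f: "graph_hom (AUQI n) (AUQI n) f"
  have image_rep: "\<exists>B. B \<in> ?V \<and> f (bipart n A) = bipart n B" if "A \<in> ?V" for A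
  proof -
    have "f (bipart n A) \<in> verts (AUQI n)"
      using f that k by (auto simp: graph_hom_def verts_AUQI)
    then show ?thesis using k by (auto simp: verts_AUQI)
  qed
  define g where "g A = (SOME B. B \<in> ?V \<and> f (bipart n A) = bipart n B)" for A
  have g: "g A \<in> ?V \<and> f (bipart n A) = bipart n (g A)" if "A \<in> ?V" for A
    unfolding g_def by (rule someI_ex) (rule image_rep[OF that])
  have "kneser_compl_endo ?N k g"
    unfolding kneser_compl_endo_def
  proof (intro conjI allI impI; elim conjE)
    fix A assume A: "A \<subseteq> ?N" "card A = k"
    show "g A \<subseteq> ?N" "card (g A) = k" using g A by auto
    fix B assume B: "B \<subseteq> ?N" "card B = k" and AB: "A \<noteq> B" "A \<inter> B \<noteq> {}"
    have "bipart n (g A) \<rightarrow>\<^bsub>AUQI n\<^esub> bipart n (g B)"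
      using f g[of A] g[of B] A B AB adj_AUQI_bipart[OF k A B]
      by (metis (mono_tags, lifting) graph_hom_def mem_Collect_eq)
    then show "g A \<noteq> g B" "g A \<inter> g B \<noteq> {}"
      using adj_AUQI_bipart[OF k, of "g A" "g B"] g[of A] g[of B] A B by auto
  qed
  then have ginj: "inj_on g ?V" using kneser_compl_endo_inj[OF k] n by simp
  have "inj_on f (verts (AUQI n))"
  proof (rule inj_onI)
    fix P Q assume "P \<in> verts (AUQI n)" "Q \<in> verts (AUQI n)" and eq: "f P = f Q"
    then obtain A B where A: "A \<in> ?V" "P = bipart n A" and B: "B \<in> ?V" "Q = bipart n B"
      using k by (auto simp: verts_AUQI)
    have "bipart n (g A) = bipart n (g B)" using eq g A B by metis
    then have "g A = g B" using g[OF A(1)] g[OF B(1)] bipart_inj[of "g A" "g B"] by simp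
    then show "P = Q" using ginj A B by (auto dest: inj_onD)
  qed
  moreover have "fin_digraph (AUQI n)" using graph_AUQI by (simp add: graph_def digraph_def)
  ultimately show "graph_automorphism (AUQI n) f"
    using f fin_digraph.inj_endomorphism_imp_automorphism by blast
qed

end

theorem theorem5p3p10:
  fixes n :: nat
  assumes "odd n" and "n \<ge> 5"
  shows "core_of (AUQI n) (QI n)"
proof -
  obtain k where n: "n = 2*k+1" using assms(1) by (auto elim: oddE)
  then have k: "k \<ge> 2" using assms(2) by simp
  have "subgraph (AUQI n) (QI n)" using induced_subgraph_AUQI by (rule induced_imp_subgraph)
  then show ?thesis
    using graph_AUQI is_core_AUQI[OF n k] exists_hom_QI_AUQI[OF n k] by (simp add: core_of_def)
qed

end
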